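(* Let $\phi(x)=a_0x^3+a_1x^2+a_2x+a_3$ with $a_i\in\mathbb{R}$, $a_0>0$, let $\gamma=\{(x,y)\in\mathbb{R}^2:y^2=\phi(x)\}$, and let $w$ be a weight function on $\Omega_\gamma=\{x\in\mathbb{R}:\phi(x)>0\}$. 1. For $n=0$ and $n=1$ define $Y_0(x,y)=1$, $Y_{1,1}(x,y)=p_1(w;x)$, $Y_{1,2}(x,y)=y$ (with the normalization $p_0(w)=p_0(\phi w)=1$). Then $\mathcal{V}_0=\mathrm{span}\{Y_0\}$ and $\mathcal{V}_1=\mathrm{span}\{Y_{1,1},Y_{1,2}\}$. Moreover $$H_0=2h_0(w),\qquad H_{1,1}=2h_1(w),\qquad H_{1,2}=2h_0(\phi w).$$ 2. For $m\ge 1$ define $$Y_{2m,1}(x,y)=p_{3m}(w;x),\quad Y_{2m,2}(x,y)=p_{3m-1}(w;x),\quad Y_{2m,3}(x,y)=y\,p_{3m-2}(\phi w;x),$$ $$Y_{2m+1,1}(x,y)=p_{3m+1}(w;x),\quad Y_{2m+1,2}(x,y)=y\,p_{3m}(\phi w;x),\quad Y_{2m+1,3}(x,y)=y\,p_{3m-1}(\phi w;x).$$ Then, for $n\ge 2$, $Y_{n,i}$ is a polynomial of degree $n$ in $\mathbb{R}[x,y]/\langle y^2-\phi(x)\rangle$ for $i=1,2,3$, and $$\mathcal{V}_n=\mathrm{span}\{Y_{n,1},Y_{n,2},Y_{n,3}\},\qquad n\ge 2.$$ Moreover, the squared norms of these polynomials are $$H_{2m,1}=2h_{3m}(w),\quad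 H_{2m,2}=2h_{3m-1}(w),\quad H_{2m,3}=2h_{3m-2}(\phi w),$$ $$H_{2m+1,1}=2h_{3m+1}(w),\quad H_{2m+1,2}=2h_{3m}(\phi w),\quad H_{2m+1,3}=2h_{3m-1}(\phi w).$$
   Context: A weight function $w$ on $\Omega_\gamma$ is a nonnegative measurable function, not almost everywhere zero, all of whose moments $\int_{\Omega_\gamma}|x|^k w(x)\,\mathrm{d}x$ are finite; its support may be a proper subset of $\Omega_\gamma$. The bilinear form $$\langle f,g\rangle_{\gamma,w}=\int_{\Omega_\gamma}\Big[f\big(x,\sqrt{\phi(x)}\big)g\big(x,\sqrt{\phi(x)}\big)+f\big(x,-\sqrt{\phi(x)}\big)g\big(x,-\sqrt{\phi(x)}\big)\Big]w(x)\,\mathrm{d}x$$ is an inner product on $\mathbb{R}[x,y]/\langle y^2-\phi(x)\rangle$. Let $\Pi_n(\gamma)$ be the image in this quotient of the polynomials in $x,y$ of total degree at most $n$ (with $\Pi_{-1}(\gamma)=\{0\}$). An element has degree $n$ in the quotient if it lies in $\Pi_n(\gamma)$ but not in $\Pi_{n-1}(\gamma)$. $\mathcal{V}_n=\mathcal{V}_n(\gamma,w)$ is the space of all $P\in\Pi_n(\gamma)$ with $\langle P,Q\rangle_{\gamma,w}=0$ for all $Q\in\Pi_{n-1}(\gamma)$. For a weight $v$ on $\Omega_\gamma$ (here $v=w$ or $v=\phi w$), $\{p_k(v)\}_{k\ge0}$ is a family of univariate orthogonal polynomials, $\deg p_k(v)=k$, with respect to $\langle f,g\rangle_v=\int_{\Omega_\gamma}f(x)g(x)v(x)\,\mathrm{d}x$;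 $p_k(v;x)$ denotes its value at $x$, and $h_k(v)=\langle p_k(v),p_k(v)\rangle_v$. Finally $H_0=\langle Y_0,Y_0\rangle_{\gamma,w}$ and $H_{n,i}=\langle Y_{n,i},Y_{n,i}\rangle_{\gamma,w}$. *)

theory Defs
  imports
    "HOL-Analysis.Analysis"
    "HOL-Computational_Algebra.Polynomial"
    "HOL-Algebra.QuotRing"
    "HOL-Algebra.Embedded_Algebras"
    "HOL-Algebra.Algebraic_Closure_Type"
begin

text \<open>
  A bivariate polynomial is a \<^typ>\<open>real poly poly\<close>: a polynomial in \<open>y\<close> whose coefficients are
  polynomials in \<open>x\<close>, so the coefficient of \<open>x^i y^j\<close> in \<open>P\<close> is \<open>coeff (coeff P j) i\<close>.
\<close>

abbreviation bipoly_ring :: "real poly poly ring" where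
  "bipoly_ring \<equiv> ring_of_type_algebra"

abbreviation in_x :: "real poly \<Rightarrow> real poly poly" where
  "in_x f \<equiv> [:f:]"

abbreviation y_var :: "real poly poly" where
  "y_var \<equiv> [:0, 1:]"

definition bieval :: "real poly poly \<Rightarrow> real \<Rightarrow> real \<Rightarrow> real" where
  "bieval P x y = poly (poly P [:y:]) x"

definition curve_ideal :: "real poly \<Rightarrow> real poly poly set" where
  "curve_ideal \<phi> = genideal bipoly_ring {y_var ^ 2 - in_x \<phi>}"

definition curve_ring :: "real poly \<Rightarrow> real poly poly set ring" where
  "curve_ring \<phi> = bipoly_ring Quot (curve_ideal \<phi>)"

definition curve_class :: "real poly \<Rightarrow> real poly poly \<Rightarrow> real poly poly set" where
  "curve_class \<phi> P = curve_ideal \<phi> +>\<^bsub>bipoly_ring\<^esub> P"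

definition curve_consts :: "real poly \<Rightarrow> real poly poly set set" where
  "curve_consts \<phi> = range (\<lambda>c. curve_class \<phi> (in_x [:c:]))"

definition curve_span :: "real poly \<Rightarrow> real poly poly set list \<Rightarrow> real poly poly set set" where
  "curve_span \<phi> As = ring.Span (curve_ring \<phi>) (curve_consts \<phi>) As"

text \<open>
  The value of a residue class at \<open>(x, y)\<close> is the common value of its representatives; it is
  only meaningful at points of the curve (lemma \<open>class_eval_curve_class\<close> below).
\<close>

definition class_eval :: "real poly poly set \<Rightarrow> real \<Rightarrow> real \<Rightarrow> real" where
  "class_eval A x y = the_elem ((\<lambda>P. bieval P x y) ` A)"

definition Omega :: "real poly \<Rightarrow> real set" where
  "Omega \<phi> = {x. poly \<phi> x > 0}"

definition weight_on :: "real set \<Rightarrow> (real \<Rightarrow> real) \<Rightarrow> bool" where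
  "weight_on S w \<longleftrightarrow>
     set_borel_measurable lebesgue S w \<and>
     (\<forall>x\<in>S. 0 \<le> w x) \<and>
     \<not> (AE x in lebesgue. x \<in> S \<longrightarrow> w x = 0) \<and>
     (\<forall>k::nat. set_integrable lebesgue S (\<lambda>x. \<bar>x\<bar> ^ k * w x))"

definition uni_inner :: "real set \<Rightarrow> (real \<Rightarrow> real) \<Rightarrow> real poly \<Rightarrow> real poly \<Rightarrow> real" where
  "uni_inner S v f g = (LINT x:S|lebesgue. poly f x * poly g x * v x)"

text \<open>The conjunct \<open>p k \<noteq> 0\<close> matters only for \<open>k = 0\<close>, as \<open>degree 0 = 0\<close>.\<close>

definition orthogonal_family :: "real set \<Rightarrow> (real \<Rightarrow> real) \<Rightarrow> (nat \<Rightarrow> real poly) \<Rightarrow> bool" where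
  "orthogonal_family S v p \<longleftrightarrow>
     (\<forall>k. p k \<noteq> 0 \<and> Polynomial.degree (p k) = k) \<and>
     (\<forall>j k. j \<noteq> k \<longrightarrow> uni_inner S v (p j) (p k) = 0)"

definition uni_norm2 :: "real set \<Rightarrow> (real \<Rightarrow> real) \<Rightarrow> (nat \<Rightarrow> real poly) \<Rightarrow> nat \<Rightarrow> real" where
  "uni_norm2 S v p k = uni_inner S v (p k) (p k)"

definition curve_inner ::
  "real poly \<Rightarrow> (real \<Rightarrow> real) \<Rightarrow> real poly poly set \<Rightarrow> real poly poly set \<Rightarrow> real" where
  "curve_inner \<phi> w A B =
     (LINT x:Omega \<phi>|lebesgue.
        (class_eval A x (sqrt (poly \<phi> x)) * class_eval B x (sqrt (poly \<phi> x))
         + class_eval A x (- sqrt (poly \<phi> x)) * class_eval B x (- sqrt (poly \<phi> x))) * w x)"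

text \<open>
  The degree bound is an integer so that \<open>n = -1\<close> is covered: only the zero polynomial has
  total degree at most \<open>-1\<close>.
\<close>

definition curve_Pi :: "real poly \<Rightarrow> int \<Rightarrow> real poly poly set set" where
  "curve_Pi \<phi> n = curve_class \<phi> ` {P. \<forall>i j. Polynomial.coeff (Polynomial.coeff P j) i \<noteq> 0 \<longrightarrow> int i + int j \<le> n}"

definition has_curve_degree :: "real poly \<Rightarrow> real poly poly set \<Rightarrow> nat \<Rightarrow> bool" where
  "has_curve_degree \<phi> A n \<longleftrightarrow> A \<in> curve_Pi \<phi> (int n) \<and> A \<notin> curve_Pi \<phi> (int n - 1)"

definition curve_V :: "real poly \<Rightarrow> (real \<Rightarrow> real) \<Rightarrow> nat \<Rightarrow> real poly poly set set" where
  "curve_V \<phi> w n =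
     {A \<in> curve_Pi \<phi> (int n). \<forall>B\<in>curve_Pi \<phi> (int n - 1). curve_inner \<phi> w A B = 0}"

text \<open>
  Here \<open>p\<close> and \<open>q\<close> play the roles of \<open>p_k(w)\<close> and \<open>p_k(\<phi> w)\<close>. The second index runs over
  \<open>{1}\<close> for \<open>n = 0\<close>, over \<open>{1, 2}\<close> for \<open>n = 1\<close>, and over \<open>{1, 2, 3}\<close> for \<open>n \<ge> 2\<close>; other
  values are junk.
\<close>

definition Y_poly ::
  "(nat \<Rightarrow> real poly) \<Rightarrow> (nat \<Rightarrow> real poly) \<Rightarrow> nat \<Rightarrow> nat \<Rightarrow> real poly poly" where
  "Y_poly p q n i =
     (let m = n div 2 in
      if n = 0 then 1
      else if n = 1 then (if i = 1 then in_x (p 1) else y_var)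
      else if even n then
        (if i = 1 then in_x (p (3 * m))
         else if i = 2 then in_x (p (3 * m - 1))
         else y_var * in_x (q (3 * m - 2)))
      else
        (if i = 1 then in_x (p (3 * m + 1))
         else if i = 2 then y_var * in_x (q (3 * m))
         else y_var * in_x (q (3 * m - 1))))"

definition Y ::
  "real poly \<Rightarrow> (nat \<Rightarrow> real poly) \<Rightarrow> (nat \<Rightarrow> real poly) \<Rightarrow> nat \<Rightarrow> nat \<Rightarrow> real poly poly set" where
  "Y \<phi> p q n i = curve_class \<phi> (Y_poly p q n i)"

definition Y_norm2 ::
  "real poly \<Rightarrow> (real \<Rightarrow> real) \<Rightarrow> (nat \<Rightarrow> real poly) \<Rightarrow> (nat \<Rightarrow> real poly) \<Rightarrow> nat \<Rightarrow> nat \<Rightarrow> real" where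
  "Y_norm2 \<phi> w p q n i = curve_inner \<phi> w (Y \<phi> p q n i) (Y \<phi> p q n i)"

lemma Y_poly_eqs:
  "Y_poly p q 0 1 = 1"
  "Y_poly p q 1 1 = in_x (p 1)"
  "Y_poly p q 1 2 = y_var"
  "m \<ge> 1 \<Longrightarrow> Y_poly p q (2 * m) 1 = in_x (p (3 * m))"
  "m \<ge> 1 \<Longrightarrow> Y_poly p q (2 * m) 2 = in_x (p (3 * m - 1))"
  "m \<ge> 1 \<Longrightarrow> Y_poly p q (2 * m) 3 = y_var * in_x (q (3 * m - 2))"
  "m \<ge> 1 \<Longrightarrow> Y_poly p q (2 * m + 1) 1 = in_x (p (3 * m + 1))"
  "m \<ge> 1 \<Longrightarrow> Y_poly p q (2 * m + 1) 2 = y_var * in_x (q (3 * m))"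
  "m \<ge> 1 \<Longrightarrow> Y_poly p q (2 * m + 1) 3 = y_var * in_x (q (3 * m - 1))"
  by (simp_all add: Y_poly_def Let_def)

lemma curve_ideal_altdef: "curve_ideal \<phi> = {P. y_var ^ 2 - in_x \<phi> dvd P}"
proof -
  interpret cring bipoly_ring by (rule cring_from_type_algebra)
  have "curve_ideal \<phi> = cgenideal bipoly_ring (y_var ^ 2 - in_x \<phi>)"
    unfolding curve_ideal_def
    by (rule cgenideal_eq_genideal[symmetric]) (simp add: ring_of_type_algebra_def)
  also have "\<dots> = {P. y_var ^ 2 - in_x \<phi> dvd P}"
    unfolding cgenideal_def ring_of_type_algebra_def dvd_def by (auto simp: mult.commute)
  finally show ?thesis .
qed

lemma mem_curve_class: "Q \<in> curve_class \<phi> P \<longleftrightarrow> y_var ^ 2 - in_x \<phi> dvd Q - P"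
proof
  assume "Q \<in> curve_class \<phi> P"
  then show "y_var ^ 2 - in_x \<phi> dvd Q - P"
    unfolding curve_class_def curve_ideal_altdef a_r_coset_def'
    by (auto simp: ring_of_type_algebra_def)
next
  assume "y_var ^ 2 - in_x \<phi> dvd Q - P"
  then show "Q \<in> curve_class \<phi> P"
    unfolding curve_class_def curve_ideal_altdef a_r_coset_def'
    by (auto simp: ring_of_type_algebra_def intro!: exI[of _ "Q - P"])
qed

lemma class_eval_curve_class:
  assumes "y ^ 2 = poly \<phi> x"
  shows "class_eval (curve_class \<phi> P) x y = bieval P x y"
proof -
  have "bieval Q x y = bieval P x y" if "Q \<in> curve_class \<phi> P" for Q
  proof -
    from that obtain R where "Q - P = (y_var ^ 2 - in_x \<phi>) * R"
      unfolding mem_curve_class dvd_def by blast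
    then have "Q = P + (y_var ^ 2 - in_x \<phi>) * R" by (simp add: algebra_simps)
    then show ?thesis using assms by (simp add: bieval_def)
  qed
  moreover have "P \<in> curve_class \<phi> P" by (simp add: mem_curve_class)
  ultimately have "(\<lambda>Q. bieval Q x y) ` curve_class \<phi> P = {bieval P x y}" by blast
  then show ?thesis by (simp add: class_eval_def)
qed

end

theory Submission
  imports Defs
begin

text \<open>
  Every class modulo \<open>y^2 - \<phi>(x)\<close> has a unique representative \<open>f(x) + y g(x)\<close>. Replacing \<open>y^2\<close> by
  the cubic \<open>\<phi>\<close> trades two units of total degree for degree three in \<open>x\<close>, and division by \<open>\<phi>\<close>
  reverses this, so membership in \<open>\<Pi>\<^sub>n(\<gamma>)\<close> amounts to separate degree bounds on \<open>f\<close> and \<open>g\<close>. The inner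
  product of \<open>f + y g\<close> and \<open>f' + y g'\<close> is twice the sum of the \<open>w\<close>-inner product of \<open>f, f'\<close> and
  the \<open>\<phi> w\<close>-inner product of \<open>g, g'\<close>. Hence the orthogonal complement splits into two univariate
  ones, each spanned by the orthogonal polynomials between the two degree bounds.
\<close>

section \<open>Integrability and the univariate inner product\<close>

text \<open>A weight supplies moments with powers of |x| only; measurability and nonnegativity on
  \<open>S\<close> turn these into moments with powers of x, and linearity gives all
  polynomials.\<close>

lemma weight_on_integrable:
  assumes "weight_on S v"
  shows "set_integrable lebesgue S (\<lambda>x. poly f x * v x)"
proof -
  have monomial: "set_integrable lebesgue S (\<lambda>x. x ^ k * v x)" for k
  proof -
    have "(\<lambda>x. x ^ k * (indicat_real S x *\<^sub>R v x)) \<in> borel_measurable lebesgue"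
      using assms unfolding weight_on_def set_borel_measurable_def
      by (intro borel_measurable_times borel_measurable_power) (auto intro: measurable_completion)
    then have "set_borel_measurable lebesgue S (\<lambda>x. x ^ k * v x)"
      unfolding set_borel_measurable_def by (simp add: mult.left_commute)
    moreover have "set_integrable lebesgue S (\<lambda>x. \<bar>x ^ k * v x\<bar>)
        \<longleftrightarrow> set_integrable lebesgue S (\<lambda>x. \<bar>x\<bar> ^ k * v x)"
      unfolding set_integrable_def
      by (intro Bochner_Integration.integrable_cong refl)
        (use assms in \<open>auto simp: weight_on_def abs_mult power_abs indicator_def\<close>)
    ultimately show ?thesis
      using assms set_integrable_abs_iff unfolding weight_on_def by blast
  qed
  \<comment> \<open>The extra factor x^k is needed for the induction: \<open>pCons a f\<close>
    evaluates to a + x f(x), so one power of x moves into the monomial.\<close>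
  have "set_integrable lebesgue S (\<lambda>x. x ^ k * poly f x * v x)" for k
  proof (induction f arbitrary: k)
    case 0
    then show ?case by (simp add: set_integrable_def)
  next
    case (pCons a f)
    have "set_integrable lebesgue S (\<lambda>x. a * (x ^ k * v x) + x ^ Suc k * poly f x * v x)"
      using pCons.IH[of "Suc k"] monomial[of k] by (intro set_integral_add) auto
    then show ?case by (simp add: algebra_simps)
  qed
  from this[of 0] show ?thesis by simp
qed

lemma uni_inner_commute: "uni_inner S v f g = uni_inner S v g f"
  by (simp add: uni_inner_def mult.commute)

lemma uni_inner_zero_left [simp]: "uni_inner S v 0 g = 0"
  by (simp add: uni_inner_def)

lemma uni_inner_zero_right [simp]: "uni_inner S v f 0 = 0"
  by (simp add: uni_inner_def)

lemma uni_inner_smult_left [simp]: "uni_inner S v (Polynomial.smult c f) g = c * uni_inner S v f g"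
  by (simp add: uni_inner_def mult.assoc)

lemma uni_inner_add_left:
  assumes "weight_on S v"
  shows "uni_inner S v (f + f') g = uni_inner S v f g + uni_inner S v f' g"
  using set_integral_add(2)[OF weight_on_integrable[OF assms, of "f * g"]
      weight_on_integrable[OF assms, of "f' * g"]]
  by (simp add: uni_inner_def algebra_simps)

lemma uni_inner_sum_left:
  assumes "weight_on S v"
  shows "uni_inner S v (\<Sum>k\<in>A. f k) g = (\<Sum>k\<in>A. uni_inner S v (f k) g)"
  by (induction A rule: infinite_finite_induct) (simp_all add: uni_inner_add_left[OF assms])

text \<open>A nonnegative integrand with integral zero vanishes almost everywhere. Since
  \<open>f\<close> has finitely many roots, \<open>v\<close> itself would then vanish almost
  everywhere on \<open>S\<close>, which a weight does not.\<close>

lemma uni_inner_self_nonzero: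
  assumes v: "weight_on S v" and "f \<noteq> 0"
  shows "uni_inner S v f f \<noteq> 0"
proof
  assume zero: "uni_inner S v f f = 0"
  have int: "integrable lebesgue (\<lambda>x. indicat_real S x * (poly f x * poly f x * v x))"
    using weight_on_integrable[OF v, of "f * f"] by (simp add: set_integrable_def)
  have "AE x in lebesgue. indicat_real S x * (poly f x * poly f x * v x) = 0"
    using zero v integral_nonneg_eq_0_iff_AE[OF int]
    by (auto simp: uni_inner_def set_lebesgue_integral_def weight_on_def indicator_def)
  moreover have "AE x in lebesgue. poly f x \<noteq> 0"
  proof -
    have "{x. poly f x = 0} \<in> null_sets lebesgue"
      using poly_roots_finite[OF \<open>f \<noteq> 0\<close>]
      by (intro null_sets_completionI finite_imp_null_set_lborel)
    from AE_not_in[OF this] show ?thesis by simp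
  qed
  ultimately have "AE x in lebesgue. x \<in> S \<longrightarrow> v x = 0"
    by eventually_elim auto
  with v show False by (simp add: weight_on_def)
qed

text \<open>Positivity of \<open>\<phi>\<close> on \<open>Omega \<phi>\<close> preserves the sign
  and the nonvanishing of \<open>w\<close>, and the moments of the product are integrals of
  polynomials against \<open>w\<close>.\<close>

lemma weight_on_Omega_mult:
  assumes w: "weight_on (Omega \<phi>) w"
  shows "weight_on (Omega \<phi>) (\<lambda>x. poly \<phi> x * w x)"
proof -
  have int: "set_integrable lebesgue (Omega \<phi>) (\<lambda>x. poly f x * (poly \<phi> x * w x))" for f
    using weight_on_integrable[OF w, of "f * \<phi>"] by (simp add: mult.assoc)
  have "set_borel_measurable lebesgue (Omega \<phi>) (\<lambda>x. poly \<phi> x * w x)"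
    using borel_measurable_integrable int[of 1]
    by (auto simp: set_borel_measurable_def set_integrable_def)
  moreover have "0 \<le> poly \<phi> x * w x" if "x \<in> Omega \<phi>" for x
    using that w by (auto simp: Omega_def weight_on_def)
  moreover have "\<not> (AE x in lebesgue. x \<in> Omega \<phi> \<longrightarrow> poly \<phi> x * w x = 0)"
  proof
    assume "AE x in lebesgue. x \<in> Omega \<phi> \<longrightarrow> poly \<phi> x * w x = 0"
    then have "AE x in lebesgue. x \<in> Omega \<phi> \<longrightarrow> w x = 0"
      by eventually_elim (auto simp: Omega_def)
    with w show False by (simp add: weight_on_def)
  qed
  moreover have "set_integrable lebesgue (Omega \<phi>) (\<lambda>x. \<bar>x\<bar> ^ k * (poly \<phi> x * w x))" for k
  proof -
    have "set_integrable lebesgue (Omega \<phi>) (\<lambda>x. \<bar>poly (Polynomial.monom 1 k) x * (poly \<phi> x * w x)\<bar>)"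
      by (rule set_integrable_abs[OF int])
    also have "?this \<longleftrightarrow> ?thesis"
      unfolding set_integrable_def
      by (intro Bochner_Integration.integrable_cong refl)
        (use w in \<open>auto simp: Omega_def weight_on_def abs_mult power_abs poly_monom indicator_def\<close>)
    finally show ?thesis .
  qed
  ultimately show ?thesis by (simp add: weight_on_def)
qed

section \<open>Polynomials of bounded degree and orthogonal expansions\<close>

text \<open>Bounding coefficients rather than the degree makes \<open>polys_below 0\<close> the zero
  space, as the case of degree -1 requires, and makes closure under linear operations
  immediate.\<close>

definition polys_below :: "nat \<Rightarrow> real poly set" where
  "polys_below N = {f. \<forall>i\<ge>N. Polynomial.coeff f i = 0}"

lemma polys_below_iff: "f \<in> polys_below N \<longleftrightarrow> f = 0 \<or> Polynomial.degree f < N"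
proof
  assume "f \<in> polys_below N"
  then show "f = 0 \<or> Polynomial.degree f < N"
    unfolding polys_below_def by (metis (mono_tags, lifting) leading_coeff_0_iff mem_Collect_eq not_less)
qed (auto simp: polys_below_def coeff_eq_0)

lemma polys_below_add: "f \<in> polys_below N \<Longrightarrow> g \<in> polys_below N \<Longrightarrow> f + g \<in> polys_below N"
  and polys_below_smult: "f \<in> polys_below N \<Longrightarrow> Polynomial.smult c f \<in> polys_below N"
  and polys_below_zero [simp]: "0 \<in> polys_below N"
  by (auto simp: polys_below_def)

lemma polys_below_sum: "(\<And>k. k \<in> A \<Longrightarrow> f k \<in> polys_below N) \<Longrightarrow> (\<Sum>k\<in>A. f k) \<in> polys_below N"
  by (auto simp: polys_below_def coeff_sum)

lemma orthogonal_family_in_polys_below: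
  "orthogonal_family S v p \<Longrightarrow> p k \<in> polys_below N \<longleftrightarrow> k < N"
  by (simp add: polys_below_iff orthogonal_family_def)

text \<open>Induction on \<open>N\<close>: subtracting the multiple of \<open>p N\<close> that
  cancels the coefficient of x^N lowers the bound by one.\<close>

lemma polys_below_expand:
  assumes "\<And>k. p k \<noteq> 0 \<and> Polynomial.degree (p k) = k"
    and "f \<in> polys_below N"
  shows "\<exists>c. f = (\<Sum>k<N. Polynomial.smult (c k) (p k))"
  using assms(2)
proof (induction N arbitrary: f)
  case 0
  then show ?case by (auto simp: polys_below_iff)
next
  case (Suc N)
  define a where "a = Polynomial.coeff f N / Polynomial.coeff (p N) N"
  have lead: "Polynomial.coeff (p N) N \<noteq> 0"
    using assms(1)[of N] leading_coeff_0_iff[of "p N"] by simp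
  have "f - Polynomial.smult a (p N) \<in> polys_below N"
    unfolding polys_below_def
  proof safe
    fix i assume "N \<le> i"
    show "Polynomial.coeff (f - Polynomial.smult a (p N)) i = 0"
    proof (cases "i = N")
      case True
      then show ?thesis using lead by (simp add: a_def)
    next
      case False
      with \<open>N \<le> i\<close> Suc.prems assms(1)[of N] show ?thesis
        by (simp add: polys_below_def coeff_eq_0)
    qed
  qed
  then obtain c where c: "f - Polynomial.smult a (p N) = (\<Sum>k<N. Polynomial.smult (c k) (p k))"
    using Suc.IH by blast
  have "f = (\<Sum>k<Suc N. Polynomial.smult ((c(N := a)) k) (p k))"
    using c by (simp add: algebra_simps)
  then show ?case by blast
qed

lemma orthogonal_family_inner_expand:
  assumes v: "weight_on S v" and p: "orthogonal_family S v p"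
    and "finite A" "j \<in> A"
  shows "uni_inner S v (\<Sum>k\<in>A. Polynomial.smult (c k) (p k)) (p j) = c j * uni_inner S v (p j) (p j)"
proof -
  have "uni_inner S v (\<Sum>k\<in>A. Polynomial.smult (c k) (p k)) (p j)
      = (\<Sum>k\<in>A. if k = j then c j * uni_inner S v (p j) (p j) else 0)"
    unfolding uni_inner_sum_left[OF v]
    by (rule sum.cong) (use p in \<open>auto simp: orthogonal_family_def\<close>)
  with assms show ?thesis by simp
qed

text \<open>Expand \<open>f\<close> in the \<open>p k\<close> with k < N. Pairing with
  \<open>p j\<close> for j < M isolates the j-th coefficient times a nonzero norm, so only indices
  from \<open>M\<close> on survive. Conversely, every \<open>g\<close> below \<open>M\<close>
  expands in \<open>p k\<close> with k < M, and these are orthogonal to the rest.\<close>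

lemma orthogonal_complement_polys_below:
  assumes v: "weight_on S v" and p: "orthogonal_family S v p" and "M \<le> N"
  shows "f \<in> polys_below N \<and> (\<forall>g\<in>polys_below M. uni_inner S v f g = 0)
    \<longleftrightarrow> (\<exists>c. f = (\<Sum>k\<in>{M..<N}. Polynomial.smult (c k) (p k)))"
proof safe
  assume f: "f \<in> polys_below N" and orth: "\<forall>g\<in>polys_below M. uni_inner S v f g = 0"
  obtain c where c: "f = (\<Sum>k<N. Polynomial.smult (c k) (p k))"
    using polys_below_expand[OF _ f, of p] p unfolding orthogonal_family_def by blast
  have "c j = 0" if "j < M" for j
  proof -
    have "c j * uni_inner S v (p j) (p j) = uni_inner S v f (p j)"
      unfolding c by (rule orthogonal_family_inner_expand[OF v p, symmetric])
        (use that \<open>M \<le> N\<close> in auto)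
    also have "\<dots> = 0"
      using orth that orthogonal_family_in_polys_below[OF p] by blast
    finally show ?thesis
      using uni_inner_self_nonzero[OF v, of "p j"] p by (simp add: orthogonal_family_def)
  qed
  then have "f = (\<Sum>k\<in>{M..<N}. Polynomial.smult (c k) (p k))"
    unfolding c by (intro sum.mono_neutral_right) (auto simp: not_le)
  then show "\<exists>c. f = (\<Sum>k\<in>{M..<N}. Polynomial.smult (c k) (p k))" by blast
next
  fix c
  show "(\<Sum>k\<in>{M..<N}. Polynomial.smult (c k) (p k)) \<in> polys_below N"
    by (intro polys_below_sum polys_below_smult)
      (simp add: orthogonal_family_in_polys_below[OF p])
next
  fix c g assume "g \<in> polys_below M"
  then obtain d where d: "g = (\<Sum>k<M. Polynomial.smult (d k) (p k))"
    using polys_below_expand[of p g M] p unfolding orthogonal_family_def by blast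
  have "uni_inner S v (p k) g = 0" if "k \<in> {M..<N}" for k
    unfolding d uni_inner_commute[of S v "p k"] uni_inner_sum_left[OF v]
    by (rule sum.neutral) (use that p in \<open>auto simp: orthogonal_family_def\<close>)
  then show "uni_inner S v (\<Sum>k\<in>{M..<N}. Polynomial.smult (c k) (p k)) g = 0"
    unfolding uni_inner_sum_left[OF v] by (intro sum.neutral) auto
qed

section \<open>The quotient ring, its operations and its spans\<close>

lemma ideal_curve_ideal: "ideal (curve_ideal \<phi>) bipoly_ring"
  unfolding curve_ideal_def
  by (rule ring.genideal_ideal[OF ring_from_type_algebra]) (simp add: ring_of_type_algebra_def)

lemma ring_curve_ring: "ring (curve_ring \<phi>)"
  unfolding curve_ring_def by (rule ideal.quotient_is_ring[OF ideal_curve_ideal])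

lemma curve_class_eq_iff: "curve_class \<phi> P = curve_class \<phi> Q \<longleftrightarrow> y_var ^ 2 - in_x \<phi> dvd P - Q"
proof
  assume "curve_class \<phi> P = curve_class \<phi> Q"
  then have "P \<in> curve_class \<phi> Q" by (metis mem_curve_class diff_self dvd_0_right)
  then show "y_var ^ 2 - in_x \<phi> dvd P - Q" by (simp add: mem_curve_class)
next
  assume PQ: "y_var ^ 2 - in_x \<phi> dvd P - Q"
  have "y_var ^ 2 - in_x \<phi> dvd R - P \<longleftrightarrow> y_var ^ 2 - in_x \<phi> dvd R - Q" for R
    using dvd_add_left_iff[OF PQ, of "R - P"] by simp
  then show "curve_class \<phi> P = curve_class \<phi> Q"
    by (auto simp: mem_curve_class set_eq_iff)
qed

lemma curve_class_add:
  "curve_class \<phi> P \<oplus>\<^bsub>curve_ring \<phi>\<^esub> curve_class \<phi> Q = curve_class \<phi> (P + Q)"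
  using ideal.a_rcos_sum[OF ideal_curve_ideal, of P Q \<phi>]
  by (simp add: curve_ring_def curve_class_def FactRing_def ring_of_type_algebra_def)

lemma curve_class_mult:
  "curve_class \<phi> P \<otimes>\<^bsub>curve_ring \<phi>\<^esub> curve_class \<phi> Q = curve_class \<phi> (P * Q)"
  using ideal.rcoset_mult_add[OF ideal_curve_ideal, of P Q \<phi>]
  by (simp add: curve_ring_def curve_class_def FactRing_def ring_of_type_algebra_def)

lemma curve_class_zero: "\<zero>\<^bsub>curve_ring \<phi>\<^esub> = curve_class \<phi> 0"
  unfolding set_eq_iff mem_curve_class
  by (simp add: curve_ring_def FactRing_def curve_ideal_altdef)

lemma curve_span_Nil: "curve_span \<phi> [] = {curve_class \<phi> 0}"
  by (simp add: curve_span_def ring.Span.simps[OF ring_curve_ring] curve_class_zero)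

text \<open>With \<open>curve_span_Nil\<close>, this unfolds the span of a concrete list into
  explicit linear combinations of representatives.\<close>

lemma curve_span_Cons:
  "curve_span \<phi> (B # Bs) =
    (\<Union>c. \<Union>C\<in>curve_span \<phi> Bs.
      {curve_class \<phi> (in_x [:c:]) \<otimes>\<^bsub>curve_ring \<phi>\<^esub> B \<oplus>\<^bsub>curve_ring \<phi>\<^esub> C})"
  by (simp add: set_eq_iff curve_span_def ring.Span.simps[OF ring_curve_ring]
      ring.line_extension_mem_iff[OF ring_curve_ring] curve_consts_def)

lemmas curve_span_simps = curve_span_Nil curve_span_Cons curve_class_add curve_class_mult

section \<open>Normal forms f(x) + y g(x) and total degree\<close>

text \<open>The generator of the ideal is monic of degree 2 in y, so it divides no nonzero
  polynomial of degree at most 1 in y.\<close>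

lemma curve_class_pair_inject:
  assumes "curve_class \<phi> [:f, g:] = curve_class \<phi> [:f', g':]"
  shows "f = f' \<and> g = g'"
proof -
  let ?M = "y_var ^ 2 - in_x \<phi>"
  have M: "?M = [:-\<phi>, 0, 1:]" by (simp add: power2_eq_square)
  have "?M dvd [:f - f', g - g':]"
    using assms by (simp add: curve_class_eq_iff)
  moreover have "Polynomial.degree [:f - f', g - g':] < Polynomial.degree ?M"
    unfolding M by simp
  ultimately have "[:f - f', g - g':] = 0"
    using dvd_imp_degree_le not_less by blast
  then show ?thesis by simp
qed

text \<open>\<open>pCons a P\<close> is a + y P, and y (f + y g) reduces to \<open>\<phi>\<close> g
  + y f. This is the Horner step for both inductions on total degree below.\<close>

lemma curve_class_pCons:
  assumes "curve_class \<phi> P = curve_class \<phi> [:f, g:]"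
  shows "curve_class \<phi> (pCons a P) = curve_class \<phi> [:a + \<phi> * g, f:]"
proof -
  obtain R where "P - [:f, g:] = (y_var ^ 2 - in_x \<phi>) * R"
    using assms unfolding curve_class_eq_iff dvd_def by blast
  then have P: "P = [:f, g:] + (y_var ^ 2 - in_x \<phi>) * R" by (simp add: algebra_simps)
  \<comment> \<open>The quotient is g + y R: g comes from replacing y^2 by \<open>\<phi>\<close>,
    and y R from the reduction of \<open>P\<close>.\<close>
  have "pCons a P - [:a + \<phi> * g, f:] = (y_var ^ 2 - in_x \<phi>) * ([:g:] + pCons 0 R)"
    unfolding P by (simp add: power2_eq_square algebra_simps)
  then show ?thesis unfolding curve_class_eq_iff by (rule dvdI)
qed

text \<open>
  \<open>\<Pi>\<^sub>k\<^sub>-\<^sub>1(\<gamma>)\<close> consists of the classes \<open>f(x) + y g(x)\<close> where \<open>f\<close> and \<open>g\<close> have at most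
  \<open>deg_bound k\<close> and \<open>deg_bound (k - 1)\<close> coefficients. The truncated subtraction makes
  \<open>deg_bound 0 = 0\<close>.
\<close>

definition deg_bound :: "nat \<Rightarrow> nat" where
  "deg_bound k = (3 * k - 1) div 2"

text \<open>Induction along the powers of y. The tail of \<open>pCons a P\<close> has its total
  degree bound lowered by one; the Horner step swaps the components of its normal form and
  multiplies one by \<open>\<phi>\<close>, which costs three degrees in x.\<close>

lemma curve_class_reduce:
  assumes "Polynomial.degree \<phi> \<le> 3"
    and "\<And>i j. Polynomial.coeff (Polynomial.coeff P j) i \<noteq> 0 \<Longrightarrow> i + j < k"
  shows "\<exists>f\<in>polys_below (deg_bound k). \<exists>g\<in>polys_below (deg_bound (k - 1)).
    curve_class \<phi> P = curve_class \<phi> [:f, g:]"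
  using assms(2)
proof (induction P arbitrary: k)
  case 0
  show ?case by (intro bexI[of _ 0]) auto
next
  case (pCons a P)
  have "i + j < k - 1" if "Polynomial.coeff (Polynomial.coeff P j) i \<noteq> 0" for i j
    using pCons.prems[of "Suc j" i] that by simp
  then obtain f g where f: "f \<in> polys_below (deg_bound (k - 1))"
    and g: "g \<in> polys_below (deg_bound (k - 1 - 1))"
    and P: "curve_class \<phi> P = curve_class \<phi> [:f, g:]"
    using pCons.IH by blast
  have a: "a \<in> polys_below (deg_bound k)"
  proof -
    have "i < k" if "Polynomial.coeff a i \<noteq> 0" for i
      using pCons.prems[of 0 i] that by simp
    moreover have "k \<le> deg_bound k" by (simp add: deg_bound_def)
    ultimately show ?thesis by (fastforce simp: polys_below_def)
  qed
  have "\<phi> * g \<in> polys_below (deg_bound k)"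
  proof (cases "g = 0")
    case False
    then have "Polynomial.degree g < deg_bound (k - 2)"
      using g by (simp add: polys_below_iff numeral_2_eq_2)
    \<comment> \<open>A nonzero \<open>g\<close> makes \<open>deg_bound (k - 2)\<close> positive, so
      k is at least 3 and no subtraction is truncated.\<close>
    moreover from this have "deg_bound k = deg_bound (k - 2) + 3"
      by (simp add: deg_bound_def)
    moreover have "Polynomial.degree (\<phi> * g) \<le> Polynomial.degree g + 3"
      using degree_mult_le[of \<phi> g] assms(1) by linarith
    ultimately show ?thesis by (simp add: polys_below_iff)
  qed simp
  with a have "a + \<phi> * g \<in> polys_below (deg_bound k)" by (rule polys_below_add)
  with f curve_class_pCons[OF P] show ?case by blast
qed

text \<open>The Horner step run backwards: with f = a + \<open>\<phi>\<close> f', the class of f + y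
  g is that of a + y (g + y f'). The pair (g, f') satisfies the bounds for the next smaller
  \<open>k\<close>, so the induction hypothesis lifts it.\<close>

lemma curve_class_lift:
  assumes \<phi>: "Polynomial.degree \<phi> = 3"
    and "f \<in> polys_below (deg_bound k)" "g \<in> polys_below (deg_bound (k - 1))"
  shows "\<exists>P. curve_class \<phi> P = curve_class \<phi> [:f, g:] \<and>
    (\<forall>i j. Polynomial.coeff (Polynomial.coeff P j) i \<noteq> 0 \<longrightarrow> i + j < k)"
  using assms(2,3)
proof (induction k arbitrary: f g)
  case 0
  then show ?case by (intro exI[of _ 0]) (auto simp: polys_below_iff deg_bound_def)
next
  case (Suc k)
  define a where "a = f mod \<phi>"
  define f' where "f' = f div \<phi>"
  have f: "f = a + \<phi> * f'" by (simp add: a_def f'_def)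
  have "\<phi> \<noteq> 0" using \<phi> by auto
  then have deg_a: "a = 0 \<or> Polynomial.degree a < 3"
    using degree_mod_less[of \<phi> f] \<phi> by (simp add: a_def)
  have deg_f': "Polynomial.degree f = Polynomial.degree f' + 3" if "f' \<noteq> 0"
  proof -
    have "Polynomial.degree (\<phi> * f') = Polynomial.degree f' + 3"
      using \<open>\<phi> \<noteq> 0\<close> that \<phi> by (simp add: degree_mult_eq)
    then show ?thesis
      unfolding f using deg_a by (auto simp: degree_add_eq_right)
  qed
  have "f' \<in> polys_below (deg_bound (k - 1))"
  proof (cases "f' = 0")
    case False
    \<comment> \<open>This is an equality for k at least 2; for smaller k the truncation makes it
      strict.\<close>
    have "deg_bound (Suc k) \<le> deg_bound (k - 1) + 3" by (simp add: deg_bound_def)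
    with False deg_f' Suc.prems(1) show ?thesis by (auto simp: polys_below_iff)
  qed simp
  with Suc.IH[of g f'] Suc.prems(2) obtain P
    where P: "curve_class \<phi> P = curve_class \<phi> [:g, f':]"
      and P_deg: "\<And>i j. Polynomial.coeff (Polynomial.coeff P j) i \<noteq> 0 \<Longrightarrow> i + j < k"
    by auto
  \<comment> \<open>The remainder has degree at most 2, which suffices once k is at least 2. For
    smaller k, \<open>f\<close> has degree below 3, so the quotient \<open>f'\<close> vanishes and
    \<open>a\<close> equals \<open>f\<close>.\<close>
  have a_lt: "i < Suc k" if "Polynomial.coeff a i \<noteq> 0" for i
  proof (cases "k < 2")
    case True
    then have k: "deg_bound (Suc k) = Suc k" by (auto simp: deg_bound_def less_2_cases_iff)
    have "f' = 0"
      using True k Suc.prems(1) deg_f' f'_def by (cases "f' = 0") (auto simp: polys_below_iff)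
    with f k Suc.prems(1) that show ?thesis by (auto simp: polys_below_def not_less[symmetric])
  next
    case False
    have "i \<le> Polynomial.degree a" using that by (rule le_degree)
    with that deg_a False show ?thesis by auto
  qed
  show ?case
  proof (intro exI conjI allI impI)
    show "curve_class \<phi> (pCons a P) = curve_class \<phi> [:f, g:]"
      using curve_class_pCons[OF P, of a] f by simp
    show "i + j < Suc k" if "Polynomial.coeff (Polynomial.coeff (pCons a P) j) i \<noteq> 0" for i j
      using that a_lt P_deg by (cases j) auto
  qed
qed

text \<open>The index is shifted so that k = 0 covers degree -1, where both bounds are 0.\<close>

lemma mem_curve_Pi_iff:
  assumes "Polynomial.degree \<phi> = 3"
  shows "A \<in> curve_Pi \<phi> (int k - 1) \<longleftrightarrow>
    (\<exists>f\<in>polys_below (deg_bound k). \<exists>g\<in>polys_below (deg_bound (k - 1)).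
      A = curve_class \<phi> [:f, g:])"
proof -
  have total: "int i + int j \<le> int k - 1 \<longleftrightarrow> i + j < k" for i j by linarith
  show ?thesis
  proof
    assume "A \<in> curve_Pi \<phi> (int k - 1)"
    then show "\<exists>f\<in>polys_below (deg_bound k). \<exists>g\<in>polys_below (deg_bound (k - 1)).
        A = curve_class \<phi> [:f, g:]"
      unfolding curve_Pi_def total using curve_class_reduce[of \<phi>] assms by auto
  next
    assume "\<exists>f\<in>polys_below (deg_bound k). \<exists>g\<in>polys_below (deg_bound (k - 1)).
        A = curve_class \<phi> [:f, g:]"
    then obtain P where "A = curve_class \<phi> P"
      "\<forall>i j. Polynomial.coeff (Polynomial.coeff P j) i \<noteq> 0 \<longrightarrow> i + j < k"
      using curve_class_lift[OF assms] by metis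
    then show "A \<in> curve_Pi \<phi> (int k - 1)"
      unfolding curve_Pi_def total by blast
  qed
qed

lemma curve_class_in_curve_Pi:
  assumes "Polynomial.degree \<phi> = 3"
  shows "curve_class \<phi> [:f, g:] \<in> curve_Pi \<phi> (int k - 1) \<longleftrightarrow>
    f \<in> polys_below (deg_bound k) \<and> g \<in> polys_below (deg_bound (k - 1))"
  unfolding mem_curve_Pi_iff[OF assms] using curve_class_pair_inject[of \<phi> f g] by blast

lemma has_curve_degree_iff:
  assumes "Polynomial.degree \<phi> = 3"
  shows "has_curve_degree \<phi> (curve_class \<phi> [:f, g:]) n \<longleftrightarrow>
    f \<in> polys_below (deg_bound (Suc n)) \<and> g \<in> polys_below (deg_bound n) \<and>
    \<not> (f \<in> polys_below (deg_bound n) \<and> g \<in> polys_below (deg_bound (n - 1)))"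
  using curve_class_in_curve_Pi[OF assms, of f g n] curve_class_in_curve_Pi[OF assms, of f g "Suc n"]
  by (simp add: has_curve_degree_def)

section \<open>The inner product on the curve and the spaces of orthogonal polynomials\<close>

text \<open>At y = s and y = -s, where s^2 = \<open>\<phi>\<close> x, the mixed terms s f g' and s g
  f' cancel in the sum, and the remaining s^2 g g' carries the factor \<open>\<phi>\<close> into the
  second weight.\<close>

lemma curve_inner_curve_class:
  assumes w: "weight_on (Omega \<phi>) w"
  shows "curve_inner \<phi> w (curve_class \<phi> [:f, g:]) (curve_class \<phi> [:f', g':]) =
    2 * uni_inner (Omega \<phi>) w f f' + 2 * uni_inner (Omega \<phi>) (\<lambda>x. poly \<phi> x * w x) g g'"
proof -
  have "curve_inner \<phi> w (curve_class \<phi> [:f, g:]) (curve_class \<phi> [:f', g':]) =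
    (LINT x:Omega \<phi>|lebesgue. 2 * (poly (f * f') x * w x) + 2 * (poly (g * g') x * (poly \<phi> x * w x)))"
    unfolding curve_inner_def set_lebesgue_integral_def
  proof (intro Bochner_Integration.integral_cong refl)
    fix x
    show "indicat_real (Omega \<phi>) x *\<^sub>R
        ((class_eval (curve_class \<phi> [:f, g:]) x (sqrt (poly \<phi> x)) *
          class_eval (curve_class \<phi> [:f', g':]) x (sqrt (poly \<phi> x)) +
          class_eval (curve_class \<phi> [:f, g:]) x (- sqrt (poly \<phi> x)) *
          class_eval (curve_class \<phi> [:f', g':]) x (- sqrt (poly \<phi> x))) * w x) =
      indicat_real (Omega \<phi>) x *\<^sub>R
        (2 * (poly (f * f') x * w x) + 2 * (poly (g * g') x * (poly \<phi> x * w x)))"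
    proof (cases "x \<in> Omega \<phi>")
      case True
      define s where "s = sqrt (poly \<phi> x)"
      have s: "poly \<phi> x = s * s" using True by (simp add: s_def Omega_def)
      show ?thesis
        using True unfolding s_def[symmetric]
        by (simp add: class_eval_curve_class power2_eq_square s bieval_def algebra_simps)
    qed simp
  qed
  also have "\<dots> = 2 * (LINT x:Omega \<phi>|lebesgue. poly (f * f') x * w x)
      + 2 * (LINT x:Omega \<phi>|lebesgue. poly (g * g') x * (poly \<phi> x * w x))"
    using weight_on_integrable[OF w, of "f * f'"]
      weight_on_integrable[OF weight_on_Omega_mult[OF w], of "g * g'"]
    by (subst set_integral_add(2)) auto
  finally show ?thesis by (simp add: uni_inner_def)
qed

text \<open>Both \<open>curve_Pi\<close> and the inner product split along the two components, so
  orthogonality can be tested on each separately.\<close>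

lemma mem_curve_V_iff:
  assumes \<phi>: "Polynomial.degree \<phi> = 3" and w: "weight_on (Omega \<phi>) w"
    and p: "orthogonal_family (Omega \<phi>) w p"
    and q: "orthogonal_family (Omega \<phi>) (\<lambda>x. poly \<phi> x * w x) q"
  shows "A \<in> curve_V \<phi> w n \<longleftrightarrow> (\<exists>f g. A = curve_class \<phi> [:f, g:] \<and>
    (\<exists>c. f = (\<Sum>k\<in>{deg_bound n..<deg_bound (Suc n)}. Polynomial.smult (c k) (p k))) \<and>
    (\<exists>d. g = (\<Sum>k\<in>{deg_bound (n - 1)..<deg_bound n}. Polynomial.smult (d k) (q k))))"
proof -
  let ?v = "\<lambda>x. poly \<phi> x * w x"
  have v: "weight_on (Omega \<phi>) ?v" by (rule weight_on_Omega_mult[OF w])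
  have Pi: "B \<in> curve_Pi \<phi> (int n) \<longleftrightarrow>
      (\<exists>f\<in>polys_below (deg_bound (Suc n)). \<exists>g\<in>polys_below (deg_bound n).
        B = curve_class \<phi> [:f, g:])" for B
    using mem_curve_Pi_iff[OF \<phi>, of B "Suc n"] by simp
  have orth: "(\<forall>B\<in>curve_Pi \<phi> (int n - 1). curve_inner \<phi> w (curve_class \<phi> [:f, g:]) B = 0) \<longleftrightarrow>
      (\<forall>f'\<in>polys_below (deg_bound n). uni_inner (Omega \<phi>) w f f' = 0) \<and>
      (\<forall>g'\<in>polys_below (deg_bound (n - 1)). uni_inner (Omega \<phi>) ?v g g' = 0)" for f g
  proof safe
    assume orth: "\<forall>B\<in>curve_Pi \<phi> (int n - 1). curve_inner \<phi> w (curve_class \<phi> [:f, g:]) B = 0"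
    have "2 * uni_inner (Omega \<phi>) w f f' + 2 * uni_inner (Omega \<phi>) ?v g g' = 0"
      if "f' \<in> polys_below (deg_bound n)" "g' \<in> polys_below (deg_bound (n - 1))" for f' g'
      using orth that curve_class_in_curve_Pi[OF \<phi>, of f' g' n]
      unfolding curve_inner_curve_class[OF w, symmetric] by blast
    \<comment> \<open>Test elements with one zero component decouple the two conditions.\<close>
    from this[of _ 0] this[of 0]
    show "f' \<in> polys_below (deg_bound n) \<Longrightarrow> uni_inner (Omega \<phi>) w f f' = 0"
      and "g' \<in> polys_below (deg_bound (n - 1)) \<Longrightarrow> uni_inner (Omega \<phi>) ?v g g' = 0" for f' g'
      by simp_all
  qed (simp add: mem_curve_Pi_iff[OF \<phi>], auto simp: curve_inner_curve_class[OF w])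
  have "deg_bound n \<le> deg_bound (Suc n)" "deg_bound (n - 1) \<le> deg_bound n"
    by (auto simp: deg_bound_def intro!: div_le_mono)
  note complement = orthogonal_complement_polys_below[OF w p this(1)]
    orthogonal_complement_polys_below[OF v q this(2)]
  have "A \<in> curve_V \<phi> w n \<longleftrightarrow> (\<exists>f g. A = curve_class \<phi> [:f, g:] \<and>
      (f \<in> polys_below (deg_bound (Suc n)) \<and>
        (\<forall>f'\<in>polys_below (deg_bound n). uni_inner (Omega \<phi>) w f f' = 0)) \<and>
      (g \<in> polys_below (deg_bound n) \<and>
        (\<forall>g'\<in>polys_below (deg_bound (n - 1)). uni_inner (Omega \<phi>) ?v g g' = 0)))"
    unfolding curve_V_def mem_Collect_eq Pi using orth by blast
  then show ?thesis unfolding complement .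
qed

section \<open>Explicit spanning sets and squared norms\<close>

text \<open>This and the next lemma replace coefficient functions by separate scalars, the form in
  which \<open>curve_span_simps\<close> presents spans.\<close>

lemma ex_sum_smult_singleton:
  "(\<exists>c. f = (\<Sum>k\<in>{a}. Polynomial.smult (c k) (p k))) \<longleftrightarrow> (\<exists>s. f = Polynomial.smult s (p a))"
  (is "?L \<longleftrightarrow> ?R")
proof
  assume ?R
  then obtain s where "f = Polynomial.smult s (p a)" ..
  then show ?L by (intro exI[of _ "\<lambda>_. s"]) simp
qed auto

lemma ex_sum_smult_pair:
  assumes "a \<noteq> b"
  shows "(\<exists>c. f = (\<Sum>k\<in>{a, b}. Polynomial.smult (c k) (p k))) \<longleftrightarrow>
    (\<exists>s t. f = Polynomial.smult s (p a) + Polynomial.smult t (p b))" (is "?L \<longleftrightarrow> ?R")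
proof
  assume ?R
  then obtain s t where "f = Polynomial.smult s (p a) + Polynomial.smult t (p b)" by blast
  then show ?L using assms by (intro exI[of _ "(\<lambda>_. t)(a := s)"]) simp
qed (use assms in auto)

theorem theorem2p2:
  fixes a0 a1 a2 a3 :: real
    and \<phi> :: "real poly"
    and w :: "real \<Rightarrow> real"
    and p q :: "nat \<Rightarrow> real poly"
  assumes phi: "\<phi> = [:a3, a2, a1, a0:]" and a0: "a0 > 0"
    and w: "weight_on (Omega \<phi>) w"
    and p: "orthogonal_family (Omega \<phi>) w p"
    and q: "orthogonal_family (Omega \<phi>) (\<lambda>x. poly \<phi> x * w x) q"
  defines "h \<equiv> uni_norm2 (Omega \<phi>) w p"
    and "h' \<equiv> uni_norm2 (Omega \<phi>) (\<lambda>x. poly \<phi> x * w x) q"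
    and "H \<equiv> Y_norm2 \<phi> w p q"
  shows
    "(p 0 = 1 \<and> q 0 = 1 \<longrightarrow>
        curve_V \<phi> w 0 = curve_span \<phi> [Y \<phi> p q 0 1] \<and>
        curve_V \<phi> w 1 = curve_span \<phi> [Y \<phi> p q 1 1, Y \<phi> p q 1 2] \<and>
        H 0 1 = 2 * h 0 \<and> H 1 1 = 2 * h 1 \<and> H 1 2 = 2 * h' 0) \<and>
     (\<forall>n\<ge>2. (\<forall>i\<in>{1, 2, 3}. has_curve_degree \<phi> (Y \<phi> p q n i) n) \<and>
        curve_V \<phi> w n = curve_span \<phi> [Y \<phi> p q n 1, Y \<phi> p q n 2, Y \<phi> p q n 3]) \<and>
     (\<forall>m\<ge>1.
        H (2 * m) 1 = 2 * h (3 * m) \<and>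
        H (2 * m) 2 = 2 * h (3 * m - 1) \<and>
        H (2 * m) 3 = 2 * h' (3 * m - 2) \<and>
        H (2 * m + 1) 1 = 2 * h (3 * m + 1) \<and>
        H (2 * m + 1) 2 = 2 * h' (3 * m) \<and>
        H (2 * m + 1) 3 = 2 * h' (3 * m - 1))"
proof -
  have deg: "Polynomial.degree \<phi> = 3" using phi a0 by simp
  let ?C = "curve_class \<phi>"
  note V = mem_curve_V_iff[OF deg w p q]
  note below = orthogonal_family_in_polys_below[OF p] orthogonal_family_in_polys_below[OF q]
  have norm: "curve_inner \<phi> w (?C [:p j, 0:]) (?C [:p j, 0:]) = 2 * h j"
    "curve_inner \<phi> w (?C [:0, q j:]) (?C [:0, q j:]) = 2 * h' j" for j
    unfolding curve_inner_curve_class[OF w] by (simp_all add: h_def h'_def uni_norm2_def)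

  have Y_even: "Y \<phi> p q (2 * m) 1 = ?C [:p (3 * m), 0:]"
    "Y \<phi> p q (2 * m) 2 = ?C [:p (3 * m - 1), 0:]"
    "Y \<phi> p q (2 * m) 3 = ?C [:0, q (3 * m - 2):]"
    and Y_odd: "Y \<phi> p q (2 * m + 1) 1 = ?C [:p (3 * m + 1), 0:]"
    "Y \<phi> p q (2 * m + 1) 2 = ?C [:0, q (3 * m):]"
    "Y \<phi> p q (2 * m + 1) 3 = ?C [:0, q (3 * m - 1):]" if "m \<ge> 1" for m
    unfolding Y_def Y_poly_eqs(4-9)[OF that] by simp_all

  have low: "curve_V \<phi> w 0 = curve_span \<phi> [Y \<phi> p q 0 1] \<and>
      curve_V \<phi> w 1 = curve_span \<phi> [Y \<phi> p q 1 1, Y \<phi> p q 1 2] \<and>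
      H 0 1 = 2 * h 0 \<and> H 1 1 = 2 * h 1 \<and> H 1 2 = 2 * h' 0"
    if "p 0 = 1" "q 0 = 1"
  proof -
    \<comment> \<open>The normalization enters here: 1 is read as p_0 and y as y q_0.\<close>
    have Y: "Y \<phi> p q 0 1 = ?C [:p 0, 0:]" "Y \<phi> p q 1 1 = ?C [:p 1, 0:]"
      "Y \<phi> p q 1 2 = ?C [:0, q 0:]"
      unfolding Y_def Y_poly_eqs(1-3) using that by (simp_all add: one_pCons)
    have bound: "{deg_bound 0..<deg_bound (Suc 0)} = {0}" "{deg_bound 1..<deg_bound (Suc 1)} = {1}"
      "{deg_bound (0 - 1)..<deg_bound 0} = {}" "{deg_bound (1 - 1)..<deg_bound 1} = {0}"
      by (auto simp: deg_bound_def)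
    have "A \<in> curve_V \<phi> w 0 \<longleftrightarrow> A \<in> curve_span \<phi> [Y \<phi> p q 0 1]" for A
      unfolding V Y bound ex_sum_smult_singleton by (simp add: curve_span_simps) blast
    moreover have "A \<in> curve_V \<phi> w 1 \<longleftrightarrow> A \<in> curve_span \<phi> [Y \<phi> p q 1 1, Y \<phi> p q 1 2]" for A
      unfolding V Y bound ex_sum_smult_singleton by (simp add: curve_span_simps) blast
    ultimately show ?thesis
      unfolding H_def Y_norm2_def Y norm by blast
  qed

  have high: "(\<forall>i\<in>{1, 2, 3}. has_curve_degree \<phi> (Y \<phi> p q n i) n) \<and>
      curve_V \<phi> w n = curve_span \<phi> [Y \<phi> p q n 1, Y \<phi> p q n 2, Y \<phi> p q n 3]" if "n \<ge> 2" for n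
  proof (cases "even n")
    case True
    then obtain m where n: "n = 2 * m" by blast
    with that have m: "m \<ge> 1" by simp
    \<comment> \<open>For even n the index ranges between consecutive bounds contain two indices for
      \<open>p\<close> and one for \<open>q\<close>.\<close>
    have bound: "deg_bound n = 3 * m - 1" "deg_bound (Suc n) = 3 * m + 1"
      "deg_bound (n - 1) = 3 * m - 2"
      using m by (auto simp: n deg_bound_def)
    \<comment> \<open>Descending order matches the order of the generators in the span.\<close>
    have ind: "{3 * m - 1..<3 * m + 1} = {3 * m, 3 * m - 1}" "{3 * m - 2..<3 * m - 1} = {3 * m - 2}"
      and "3 * m \<noteq> 3 * m - 1"
      using m by auto
    note pair = ex_sum_smult_pair[OF this(3)]
    have "A \<in> curve_V \<phi> w n \<longleftrightarrow>
        A \<in> curve_span \<phi> [Y \<phi> p q n 1, Y \<phi> p q n 2, Y \<phi> p q n 3]" for A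
      unfolding V bound ind ex_sum_smult_singleton pair unfolding n Y_even[OF m]
      by (simp add: curve_span_simps) blast
    \<comment> \<open>Each index reaches the lower end of its range, so the bound for degree n - 1
      fails in that component.\<close>
    moreover have "\<forall>i\<in>{1, 2, 3}. has_curve_degree \<phi> (Y \<phi> p q n i) n"
      using m unfolding ball_simps n Y_even[OF m] has_curve_degree_iff[OF deg]
      unfolding n[symmetric] bound by (auto simp: below)
    ultimately show ?thesis by blast
  next
    case False
    then obtain m where n: "n = 2 * m + 1" using oddE by blast
    with that have m: "m \<ge> 1" by simp
    \<comment> \<open>For odd n the counts are reversed: one index for \<open>p\<close>, two for
      \<open>q\<close>.\<close>
    have bound: "deg_bound n = 3 * m + 1" "deg_bound (Suc n) = 3 * m + 2"
      "deg_bound (n - 1) = 3 * m - 1"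
      using m by (auto simp: n deg_bound_def)
    have ind: "{3 * m + 1..<3 * m + 2} = {3 * m + 1}" "{3 * m - 1..<3 * m + 1} = {3 * m, 3 * m - 1}"
      and "3 * m \<noteq> 3 * m - 1"
      using m by auto
    note pair = ex_sum_smult_pair[OF this(3)]
    have "A \<in> curve_V \<phi> w n \<longleftrightarrow>
        A \<in> curve_span \<phi> [Y \<phi> p q n 1, Y \<phi> p q n 2, Y \<phi> p q n 3]" for A
      unfolding V bound ind ex_sum_smult_singleton pair unfolding n Y_odd[OF m]
      by (simp add: curve_span_simps) blast
    moreover have "\<forall>i\<in>{1, 2, 3}. has_curve_degree \<phi> (Y \<phi> p q n i) n"
      using m unfolding ball_simps n Y_odd[OF m] has_curve_degree_iff[OF deg]
      unfolding n[symmetric] bound by (auto simp: below)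
    ultimately show ?thesis by blast
  qed

  have norms: "H (2 * m) 1 = 2 * h (3 * m) \<and> H (2 * m) 2 = 2 * h (3 * m - 1) \<and>
      H (2 * m) 3 = 2 * h' (3 * m - 2) \<and> H (2 * m + 1) 1 = 2 * h (3 * m + 1) \<and>
      H (2 * m + 1) 2 = 2 * h' (3 * m) \<and> H (2 * m + 1) 3 = 2 * h' (3 * m - 1)" if "m \<ge> 1" for m
    unfolding H_def Y_norm2_def Y_even[OF that] Y_odd[OF that] norm by simp

  show ?thesis using low high norms by blast
qed

end
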